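(* Assume that: (i) for every $i\in\{1,\dots,N\}$ the function $f_i:\mathbb{R}^d\to\mathbb{R}$ is differentiable and strongly convex with coefficient $\alpha>0$; (ii) for every $i$ the gradient $\nabla f_i$ is Lipschitz continuous with constant $\beta>0$; (iii) the graph $\mathcal{G}$ is undirected and connected. Let $x^\star\in\mathbb{R}^d$ be the unique minimizer of $\sum_{i=1}^N f_i$. Consider the Continuous Gradient Tracking system, $t\ge 0$, $$\dot x(t) = -L x(t) - z(t) - \nabla\mathbf{f}(x(t)),\qquad \dot z(t) = -L z(t) - L\,\nabla\mathbf{f}(x(t)),$$ with state $x(t)=\mathrm{col}(x_1(t),\dots,x_N(t))\in\mathbb{R}^{Nd}$, $z(t)=\mathrm{col}(z_1(t),\dots,z_N(t))\in\mathbb{R}^{Nd}$, and pick any initial condition $(x(0),z(0))$ such that $\sum_{i=1}^N z_i(0)=0$. Then there exist $a_1>0$ and $a_2>0$ such that $$\|x_i(t)-x^\star\|\le a_1\exp(-a_2 t)\qquad\text{for all } t\ge 0 \text{ and all } i\in\{1,\dots,N\}.$$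
   Context: $N$ agents communicate over a graph $\mathcal{G}=(\{1,\dots,N\},\mathcal{E})$. $\mathcal{W}=[w_{ij}]\in\mathbb{R}^{N\times N}$ is a symmetric weighted adjacency matrix with $w_{ij}>0$ if $(i,j)\in\mathcal{E}$ and $w_{ij}=0$ otherwise ($\mathcal{G}$ contains self-loops). $\mathcal{D}=\mathrm{diag}(d_1,\dots,d_N)$ with $d_i=\sum_j w_{ij}$, $\mathcal{L}=\mathcal{D}-\mathcal{W}$ is the weighted Laplacian, and $L=\mathcal{L}\otimes I_d\in\mathbb{R}^{Nd\times Nd}$ (Kronecker product). For $x=\mathrm{col}(x_1,\dots,x_N)$ with $x_i\in\mathbb{R}^d$, $\nabla\mathbf{f}(x)=\mathrm{col}(\nabla f_1(x_1),\dots,\nabla f_N(x_N))$; $\mathrm{col}$ denotes vertical concatenation. $\|\cdot\|$ is the Euclidean norm. *)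

theory Defs
  imports "HOL-Analysis.Analysis"
begin

text \<open>
  Agents are the elements of a finite type \<open>'n\<close>, local variables live in \<open>real ^ 'd\<close>, and stacked
  vectors in \<open>\<real>\<^sup>N\<^sup>d\<close> are indexed by pairs (agent, coordinate).
\<close>

definition col :: "('n \<Rightarrow> real ^ 'd) \<Rightarrow> real ^ ('n::finite \<times> 'd::finite)" where
  "col v = (\<chi> p. v (fst p) $ snd p)"

definition block :: "real ^ ('n::finite \<times> 'd::finite) \<Rightarrow> 'n \<Rightarrow> real ^ 'd" where
  "block x i = (\<chi> k. x $ (i, k))"

definition kronecker ::
  "real ^ 'n ^ 'm \<Rightarrow> real ^ 'e ^ 'd \<Rightarrow> real ^ ('n::finite \<times> 'e::finite) ^ ('m::finite \<times> 'd::finite)"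
  where "kronecker A B = (\<chi> p q. A $ fst p $ fst q * B $ snd p $ snd q)"

definition undirected_connected :: "('n \<times> 'n) set \<Rightarrow> bool" where
  "undirected_connected E \<longleftrightarrow> sym E \<and> (\<forall>i j. (i, j) \<in> E\<^sup>*)"

definition weighted_adjacency :: "('n \<times> 'n) set \<Rightarrow> real ^ 'n ^ 'n::finite \<Rightarrow> bool" where
  "weighted_adjacency E W \<longleftrightarrow> transpose W = W \<and>
     (\<forall>i j. if (i, j) \<in> E then W $ i $ j > 0 else W $ i $ j = 0)"

definition degree_matrix :: "real ^ 'n ^ 'n \<Rightarrow> real ^ 'n ^ 'n::finite" where
  "degree_matrix W = (\<chi> i j. if i = j then \<Sum>k\<in>UNIV. W $ i $ k else 0)"

definition laplacian :: "real ^ 'n ^ 'n \<Rightarrow> real ^ 'n ^ 'n::finite" where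
  "laplacian W = degree_matrix W - W"

text \<open>\<open>gradient f x\<close> is meaningful only where \<open>f\<close> is differentiable; there it is unique.\<close>

definition gradient :: "('a::real_inner \<Rightarrow> real) \<Rightarrow> 'a \<Rightarrow> 'a" where
  "gradient f x = (THE g. GDERIV f x :> g)"

definition strongly_convex :: "real \<Rightarrow> ('a::real_inner \<Rightarrow> real) \<Rightarrow> bool" where
  "strongly_convex \<alpha> f \<longleftrightarrow> (\<forall>x y. \<forall>\<theta>\<in>{0..1}.
     f (\<theta> *\<^sub>R x + (1 - \<theta>) *\<^sub>R y)
       \<le> \<theta> * f x + (1 - \<theta>) * f y - \<alpha> / 2 * \<theta> * (1 - \<theta>) * (norm (x - y))\<^sup>2)"

definition stacked_gradient ::
  "('n \<Rightarrow> real ^ 'd \<Rightarrow> real) \<Rightarrow> real ^ ('n::finite \<times> 'd::finite) \<Rightarrow> real ^ ('n \<times> 'd)" where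
  "stacked_gradient f x = col (\<lambda>i. gradient (f i) (block x i))"

definition gradient_tracking_solution ::
  "real ^ 'n ^ 'n \<Rightarrow> ('n \<Rightarrow> real ^ 'd \<Rightarrow> real) \<Rightarrow>
   (real \<Rightarrow> real ^ ('n::finite \<times> 'd::finite)) \<Rightarrow> (real \<Rightarrow> real ^ ('n \<times> 'd)) \<Rightarrow> bool" where
  "gradient_tracking_solution W f x z \<longleftrightarrow>
     (let L = kronecker (laplacian W) (mat 1 :: real ^ 'd ^ 'd) in
      \<forall>t\<ge>0.
        (x has_vector_derivative - (L *v x t) - z t - stacked_gradient f (x t))
          (at t within {0..}) \<and>
        (z has_vector_derivative - (L *v z t) - L *v stacked_gradient f (x t))
          (at t within {0..}))"

end

theory Submission
  imports Defs
begin

text \<open>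
  Let \<open>x\<^sup>*\<close> also denote the stacked minimizer, on which \<open>L\<close> vanishes. The errors \<open>e = x - x\<^sup>*\<close> and
  \<open>p = z - L x + \<nabla>f(x\<^sup>*)\<close> satisfy \<open>e' = - 2 L e - p - (\<nabla>f(x) - \<nabla>f(x\<^sup>*))\<close> and \<open>p' = L\<^sup>2 e\<close>, and
  \<open>p(0)\<close> is orthogonal to the consensus space \<open>ker L\<close>, by the condition on \<open>z(0)\<close> and the optimality
  of \<open>x\<^sup>*\<close>. Hence \<open>p = L r\<close> for some \<open>r\<close> in the range of \<open>L\<close> with \<open>r' = L e\<close>. This is a saddle-point
  flow, for which \<open>(\<parallel>e\<parallel>\<^sup>2 + \<parallel>r\<parallel>\<^sup>2) / 2 + \<epsilon> e \<bullet> L r\<close> is a strict Lyapunov function for small \<open>\<epsilon>\<close>.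
\<close>

section \<open>Exponential decay of saddle-point flows\<close>

lemma young_ineq:
  fixes a b c :: real
  shows "c * a * b \<le> a\<^sup>2 / 2 + c\<^sup>2 / 2 * b\<^sup>2"
proof -
  have "0 \<le> (a - c * b)\<^sup>2" by simp
  then show ?thesis by (simp add: power2_eq_square algebra_simps)
qed

text \<open>Differential form of Gronwall's inequality: \<open>V t * exp (c * t)\<close> has
  derivative \<open>(V' t + c * V t) * exp (c * t)\<close>, which is nonpositive.\<close>

lemma exp_decay_of_deriv_le:
  fixes V :: "real \<Rightarrow> real"
  assumes deriv: "\<And>t. t \<ge> 0 \<Longrightarrow> (V has_vector_derivative V' t) (at t within {0..})"
    and le: "\<And>t. t \<ge> 0 \<Longrightarrow> V' t \<le> - c * V t"
    and "t \<ge> 0"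
  shows "V t \<le> V 0 * exp (- c * t)"
proof -
  let ?g = "\<lambda>t. V t * exp (c * t)"
  have d: "(?g has_real_derivative V' s * exp (c * s) + V s * (c * exp (c * s))) (at s within {0..})"
    if "s \<ge> 0" for s
    using deriv[OF that] unfolding has_real_derivative_iff_has_vector_derivative[symmetric]
    by (auto intro!: derivative_eq_intros)
  have "?g t \<le> ?g 0"
  \<comment> \<open>The derivative at \<open>0\<close> is one-sided, so the endpoint contributes
    continuity only.\<close>
  proof (rule DERIV_nonpos_imp_decreasing_open[OF \<open>t \<ge> 0\<close>])
    fix s :: real assume s: "0 < s" "s < t"
    have "at s within {0..} = at s"
      using s by (intro at_within_interior) (simp add: interior_real_atLeast)
    moreover have "V' s * exp (c * s) + V s * (c * exp (c * s)) = (V' s + c * V s) * exp (c * s)"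
      by (simp add: algebra_simps)
    moreover have "(V' s + c * V s) * exp (c * s) \<le> 0"
      using le[of s] s by (intro mult_nonpos_nonneg) auto
    ultimately show "\<exists>y. DERIV ?g s :> y \<and> y \<le> 0"
      using d[of s] s by auto
  next
    have "continuous_on {0..} ?g"
      using d by (intro continuous_on_vector_derivative)
        (auto simp flip: has_real_derivative_iff_has_vector_derivative)
    then show "continuous_on {0..t} ?g"
      by (rule continuous_on_subset) auto
  qed
  then have "V t * exp (c * t) * exp (- c * t) \<le> V 0 * exp (- c * t)"
    by (intro mult_right_mono) auto
  then show ?thesis
    by (simp add: mult.assoc flip: exp_add)
qed

text \<open>A self-adjoint map splits the space orthogonally into range and kernel. The double
  \<open>L\<close> says that the preimage of \<open>p\<close> can itself be taken in the range,
  where \<open>L\<close> is invertible.\<close>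

lemma selfadjoint_orthogonal_kernel_imp_range:
  fixes L :: "'a::euclidean_space \<Rightarrow> 'a"
  assumes "linear L" and adj: "\<And>x y. L x \<bullet> y = x \<bullet> L y"
    and p: "\<And>b. L b = 0 \<Longrightarrow> p \<bullet> b = 0"
  obtains y where "p = L (L y)"
proof -
  interpret linear L by fact
  have sub: "span (range L) = range L"
    by (simp add: span_eq_iff linear_subspace_image \<open>linear L\<close>)
  have decomp: "\<exists>y b. u = L y + b \<and> L b = 0" for u
  proof -
    obtain a b where ab: "a \<in> span (range L)" "\<And>w. w \<in> span (range L) \<Longrightarrow> orthogonal b w" "u = a + b"
      using orthogonal_subspace_decomp_exists[of "range L" u] by metis
    \<comment> \<open>By self-adjointness this number is the squared norm of
      \<open>L b\<close>.\<close>
    have "b \<bullet> L (L b) = 0"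
      using ab(2)[of "L (L b)"] by (simp add: sub orthogonal_def)
    then have "L b = 0"
      by (metis adj inner_eq_zero_iff)
    with ab show ?thesis
      unfolding sub by auto
  qed
  obtain u b where u: "p = L u + b" "L b = 0"
    using decomp by blast
  have "b \<bullet> b = 0"
    using p[OF u(2)] u by (simp add: inner_left_distrib adj)
  \<comment> \<open>Splitting the preimage again discards its kernel part, which \<open>L\<close>
    does not see.\<close>
  moreover obtain y b' where "u = L y + b'" "L b' = 0"
    using decomp by blast
  ultimately show thesis
    using u that[of y] by (simp add: add)
qed

text \<open>\<open>g\<close> stands for the gradient difference and enters through two bounds along
  the trajectory. \<open>A\<close> and \<open>c\<close> are chosen before the trajectory, so they
  serve all solutions at once.\<close>

lemma saddle_flow_decay:
  fixes L :: "'a::euclidean_space \<Rightarrow> 'a"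
  assumes linL: "linear L" and adj: "\<And>x y. L x \<bullet> y = x \<bullet> L y" and psd: "\<And>x. 0 \<le> x \<bullet> L x"
    and "\<alpha> > 0" and "\<beta> \<ge> 0"
  shows "\<exists>A>0. \<exists>c>0. \<forall>e p g.
    (\<forall>t\<ge>0. (e has_vector_derivative - (2 *\<^sub>R L (e t)) - p t - g t) (at t within {0..}) \<and>
      (p has_vector_derivative L (L (e t))) (at t within {0..}) \<and>
      \<alpha> * (norm (e t))\<^sup>2 \<le> e t \<bullet> g t \<and> norm (g t) \<le> \<beta> * norm (e t)) \<and>
    (\<forall>b. L b = 0 \<longrightarrow> p 0 \<bullet> b = 0) \<longrightarrow>
    (\<forall>t\<ge>0. norm (e t) \<le> A * (norm (e 0) + norm (p 0)) * exp (- c * t))"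
proof -
  interpret L: linear L by fact
  have sub: "subspace (range L)"
    by (simp add: linear_subspace_image \<open>linear L\<close>)
  have "inj_on L (range L)"
  proof (rule inj_onI)
    fix x y assume "x \<in> range L" "y \<in> range L" and eq: "L x = L y"
    then obtain u where u: "x - y = L u"
      by (metis L.diff imageE)
    have "(x - y) \<bullet> (x - y) = u \<bullet> L (x - y)"
      using u by (metis adj)
    also have "\<dots> = 0"
      using eq by (simp add: L.diff)
    finally show "x = y" by simp
  qed
  \<comment> \<open>A linear \<open>M\<close> on the whole space can be applied to \<open>p\<close>
    and differentiated before \<open>p\<close> is known to stay in the range.\<close>
  then obtain M where linM: "linear M" and M_inv: "\<And>y. M (L (L y)) = L y"
    using linear_exists_left_inverse_on[OF linL sub] by blast
  obtain B where B: "B > 0" "\<And>x. norm (L x) \<le> B * norm x"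
    using linear_bounded_pos[OF linL] by blast
  obtain K where K: "K > 0" "\<And>x. norm (M x) \<le> K * norm x"
    using linear_bounded_pos[OF linM] by blast
  \<comment> \<open>Coefficient of the squared norm of \<open>e\<close> in the derivative of
    \<open>e \<bullet> p\<close>: the first summand comes from Young's inequality, the second from
    the square of \<open>L e\<close>.\<close>
  define C where "C = (2 * B + \<beta>)\<^sup>2 / 2 + B\<^sup>2"
  have "C > 0" using B by (simp add: C_def add_nonneg_pos)
  \<comment> \<open>The first bound spends at most half of the dissipation \<open>\<alpha>\<close>;
    the second keeps the cross term below a quarter of the squared norms, so that \<open>V\<close>
    stays comparable to them.\<close>
  define \<epsilon> where "\<epsilon> = min (\<alpha> / (2 * C)) (1 / (2 * B))"
  have \<epsilon>: "\<epsilon> > 0" "\<epsilon> * C \<le> \<alpha> / 2" "\<epsilon> * B \<le> 1 / 2"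
    using \<open>\<alpha> > 0\<close> \<open>C > 0\<close> \<open>B > 0\<close> by (auto simp: \<epsilon>_def min_def field_simps)
  \<comment> \<open>The rates left over for \<open>e\<close> and for \<open>r\<close>; the latter
    uses that \<open>r\<close> is bounded by \<open>K\<close> times \<open>p\<close>.\<close>
  define c where "c = min (\<alpha> / 2) (\<epsilon> / (2 * K\<^sup>2))"
  have c: "c > 0" "c \<le> \<alpha> / 2" "c * K\<^sup>2 \<le> \<epsilon> / 2"
    using \<open>\<alpha> > 0\<close> \<epsilon> \<open>K > 0\<close> by (auto simp: c_def min_def field_simps)
  have main: "norm (e t) \<le> (2 * (1 + K)) * (norm (e 0) + norm (p 0)) * exp (- (c / 2) * t)"
    if de: "\<And>t. t \<ge> 0 \<Longrightarrow>
          (e has_vector_derivative - (2 *\<^sub>R L (e t)) - p t - g t) (at t within {0..})"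
      and dp: "\<And>t. t \<ge> 0 \<Longrightarrow> (p has_vector_derivative L (L (e t))) (at t within {0..})"
      and mono: "\<And>t. t \<ge> 0 \<Longrightarrow> \<alpha> * (norm (e t))\<^sup>2 \<le> e t \<bullet> g t"
      and lip: "\<And>t. t \<ge> 0 \<Longrightarrow> norm (g t) \<le> \<beta> * norm (e t)"
      and perp: "\<And>b. L b = 0 \<Longrightarrow> p 0 \<bullet> b = 0"
      and "t \<ge> 0" for e p g t
  proof -
    define r where "r = (\<lambda>t. M (p t))" \<comment> \<open>\<open>M\<close> inverts \<open>L\<close> on its range only\<close>
    have dr: "(r has_vector_derivative L (e t)) (at t within {0..})" if "t \<ge> 0" for t
      using bounded_linear.has_vector_derivative[OF _ dp[OF that], of M] linM
      by (simp add: r_def M_inv linear_linear)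
    have dLr: "((\<lambda>t. L (r t)) has_vector_derivative L (L (e t))) (at t within {0..})"
      if "t \<ge> 0" for t
      using bounded_linear.has_vector_derivative[OF _ dr[OF that], of L] linL
      by (simp add: linear_linear)
    obtain y0 where y0: "p 0 = L (L y0)"
      using selfadjoint_orthogonal_kernel_imp_range[OF linL adj perp] by blast
    \<comment> \<open>Both terms have derivative \<open>L (L (e t))\<close> and agree at time
      \<open>0\<close>, so \<open>p\<close> never leaves the range of \<open>L\<close>.\<close>
    have "\<exists>k. \<forall>t\<in>{0..}. L (r t) - p t = k"
    proof (rule has_vector_derivative_zero_constant)
      show "((\<lambda>t. L (r t) - p t) has_vector_derivative 0) (at t within {0..})"
        if "t \<in> {0..}" for t
        using has_vector_derivative_diff[OF dLr dp] that by fastforce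
    qed auto
    moreover have "L (r 0) = p 0"
      by (simp add: r_def y0 M_inv)
    ultimately have Lr: "L (r t) = p t" if "t \<ge> 0" for t
      using that by (metis atLeast_iff diff_self order_refl right_minus_eq)
    \<comment> \<open>The plain energy dissipates in \<open>e\<close> only; the derivative of the
      cross term supplies the missing negative square of \<open>p\<close>.\<close>
    define V where "V = (\<lambda>t. (e t \<bullet> e t + r t \<bullet> r t) / 2 + \<epsilon> * (e t \<bullet> p t))"
    define e' where "e' = (\<lambda>t. - (2 *\<^sub>R L (e t)) - p t - g t)"
    define V' where "V' = (\<lambda>t. e t \<bullet> e' t + r t \<bullet> L (e t) + \<epsilon> * (e' t \<bullet> p t + e t \<bullet> L (L (e t))))"
    have de': "(e has_vector_derivative e' t) (at t within {0..})" if "t \<ge> 0" for t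
      using de[OF that] by (simp add: e'_def)
    have dV: "(V has_vector_derivative V' t) (at t within {0..})" if "t \<ge> 0" for t
      unfolding V_def V'_def
      using de'[OF that] dp[OF that] dr[OF that]
      unfolding has_vector_derivative_def
      by (auto intro!: derivative_eq_intros ext simp: inner_commute algebra_simps)
    define S where "S = (\<lambda>t. (norm (e t))\<^sup>2 + (norm (r t))\<^sup>2)"
    have V_S: "S t / 4 \<le> V t" "V t \<le> S t" if "t \<ge> 0" for t
    proof -
      have "\<bar>e t \<bullet> p t\<bar> \<le> norm (e t) * (B * norm (r t))"
        using Cauchy_Schwarz_ineq2[of "e t" "p t"] B(2)[of "r t"] Lr[OF that]
        by (metis mult_left_mono norm_ge_zero order_trans)
      then have "\<bar>\<epsilon> * (e t \<bullet> p t)\<bar> \<le> \<epsilon> * (norm (e t) * (B * norm (r t)))"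
        using \<epsilon>(1) by (simp add: abs_mult)
      also have "\<dots> = (\<epsilon> * B) * (norm (e t) * norm (r t))"
        by simp
      also have "\<dots> \<le> 1 / 2 * (norm (e t) * norm (r t))"
        using \<epsilon>(3) by (intro mult_right_mono) auto
      also have "\<dots> \<le> S t / 4"
        using young_ineq[of 1 "norm (e t)" "norm (r t)"] by (simp add: S_def)
      finally have "\<bar>\<epsilon> * (e t \<bullet> p t)\<bar> \<le> S t / 4" .
      moreover have "V t = S t / 2 + \<epsilon> * (e t \<bullet> p t)"
        by (simp add: V_def S_def dot_square_norm)
      moreover have "S t \<ge> 0" by (simp add: S_def)
      ultimately show "S t / 4 \<le> V t" "V t \<le> S t" by linarith+
    qed
    have V'_le: "V' t \<le> - c * V t" if "t \<ge> 0" for t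
    proof -
      \<comment> \<open>The coupling of \<open>e\<close> and \<open>r\<close> is skew and cancels in
        the energy balance; the term \<open>2 *\<^sub>R L (e t)\<close> only adds damping.\<close>
      have "e t \<bullet> p t = r t \<bullet> L (e t)"
        using Lr[OF that] adj by (metis inner_commute)
      then have 1: "e t \<bullet> e' t + r t \<bullet> L (e t) \<le> - \<alpha> * (norm (e t))\<^sup>2"
        using mono[OF that] psd[of "e t"] by (simp add: e'_def inner_diff_right)
      have "norm (2 *\<^sub>R L (e t) + g t) \<le> (2 * B + \<beta>) * norm (e t)"
        using norm_triangle_ineq[of "2 *\<^sub>R L (e t)" "g t"] B(2)[of "e t"] lip[OF that]
        by (simp add: algebra_simps)
      then have "\<bar>(2 *\<^sub>R L (e t) + g t) \<bullet> p t\<bar> \<le> (2 * B + \<beta>) * norm (e t) * norm (p t)"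
        using Cauchy_Schwarz_ineq2[of "2 *\<^sub>R L (e t) + g t" "p t"]
        by (meson mult_right_mono norm_ge_zero order_trans)
      moreover have "e' t \<bullet> p t = - ((2 *\<^sub>R L (e t) + g t) \<bullet> p t) - (norm (p t))\<^sup>2"
        by (simp add: e'_def inner_diff_left inner_add_left dot_square_norm)
      moreover have "e t \<bullet> L (L (e t)) = (norm (L (e t)))\<^sup>2"
        by (simp add: dot_square_norm flip: adj)
      moreover have "(norm (L (e t)))\<^sup>2 \<le> B\<^sup>2 * (norm (e t))\<^sup>2"
        using B(2)[of "e t"] by (metis norm_ge_zero power_mono power_mult_distrib)
      \<comment> \<open>Young's inequality absorbs the mixed term using half of the negative square
        of \<open>p\<close>.\<close>
      ultimately have 2: "e' t \<bullet> p t + e t \<bullet> L (L (e t)) \<le> C * (norm (e t))\<^sup>2 - (norm (p t))\<^sup>2 / 2"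
        using young_ineq[of "2 * B + \<beta>" "norm (p t)" "norm (e t)"]
        unfolding C_def distrib_right[of _ _ "(norm (e t))\<^sup>2"]
          mult.assoc[of "2 * B + \<beta>"] mult.commute[of "norm (p t)"]
        by linarith
      have "(norm (r t))\<^sup>2 \<le> K\<^sup>2 * (norm (p t))\<^sup>2"
        using K(2)[of "p t"] by (metis r_def norm_ge_zero power_mono power_mult_distrib)
      then have "c * (norm (r t))\<^sup>2 \<le> (c * K\<^sup>2) * (norm (p t))\<^sup>2"
        using c(1) by (simp add: mult.assoc)
      also have "\<dots> \<le> \<epsilon> / 2 * (norm (p t))\<^sup>2"
        using c(3) by (intro mult_right_mono) auto
      finally have 3: "c * (norm (r t))\<^sup>2 \<le> \<epsilon> / 2 * (norm (p t))\<^sup>2" .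
      \<comment> \<open>What remains is at most \<open>- (\<alpha> / 2)\<close> times the square of
        \<open>e\<close> minus \<open>\<epsilon> / 2\<close> times the square of \<open>p\<close>,
        hence at most \<open>- c * S t\<close>.\<close>
      have "\<epsilon> * (e' t \<bullet> p t + e t \<bullet> L (L (e t))) \<le> \<epsilon> * (C * (norm (e t))\<^sup>2 - (norm (p t))\<^sup>2 / 2)"
        using 2 \<epsilon>(1) by (intro mult_left_mono) auto
      moreover have "(\<epsilon> * C) * (norm (e t))\<^sup>2 \<le> \<alpha> / 2 * (norm (e t))\<^sup>2"
        using \<epsilon>(2) by (intro mult_right_mono) auto
      moreover have "c * (norm (e t))\<^sup>2 \<le> \<alpha> / 2 * (norm (e t))\<^sup>2"
        using c(2) by (intro mult_right_mono) auto
      moreover have "c * V t \<le> c * S t"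
        using V_S[OF that] c(1) by simp
      ultimately show ?thesis
        using 1 3 by (simp add: V'_def S_def algebra_simps)
    qed
    have "(norm (e t))\<^sup>2 \<le> S t"
      by (simp add: S_def)
    also have "\<dots> \<le> 4 * V t"
      using V_S(1)[OF \<open>t \<ge> 0\<close>] by simp
    also have "\<dots> \<le> 4 * (V 0 * exp (- c * t))"
      using exp_decay_of_deriv_le[OF dV V'_le \<open>t \<ge> 0\<close>] by simp
    also have "\<dots> \<le> 4 * (S 0 * exp (- c * t))"
      using V_S(2)[of 0] by simp
    also have "\<dots> \<le> 4 * ((norm (e 0) + norm (r 0))\<^sup>2 * exp (- c * t))"
      by (simp add: S_def power2_sum)
    \<comment> \<open>The square root of the estimate halves the rate, hence
      \<open>c / 2\<close>.\<close>
    also have "\<dots> = (2 * (norm (e 0) + norm (r 0)) * exp (- (c / 2) * t))\<^sup>2"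
      by (simp add: power_mult_distrib del: distrib_left_numeral flip: exp_double)
    finally have "norm (e t) \<le> 2 * (norm (e 0) + norm (r 0)) * exp (- (c / 2) * t)"
      by (rule power2_le_imp_le) simp
    also have "norm (e 0) + norm (r 0) \<le> (1 + K) * (norm (e 0) + norm (p 0))"
      using K(1) K(2)[of "p 0"] by (simp add: r_def algebra_simps add_increasing)
    finally show ?thesis
      by (simp add: mult.assoc del: distrib_left_numeral)
  qed
  show ?thesis
    by (rule exI[of _ "2 * (1 + K)"], intro conjI, use K(1) in simp,
        rule exI[of _ "c / 2"], intro conjI, use c(1) in simp) (blast intro: main)
qed

section \<open>Gradients and strong convexity\<close>

lemma GDERIV_unique:
  assumes "GDERIV f x :> g" "GDERIV f x :> h"
  shows "g = h"
proof -
  have "(\<lambda>v. v \<bullet> g) = (\<lambda>v. v \<bullet> h)"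
    using assms unfolding gderiv_def by (rule has_derivative_unique)
  then show ?thesis
    by (metis inner_commute vector_eq_ldot)
qed

text \<open>\<open>adjoint f' 1\<close> is the Riesz representer of the derivative; with uniqueness
  it makes the \<open>THE\<close> in \<open>gradient\<close> well defined.\<close>

lemma GDERIV_gradient:
  fixes f :: "'a::euclidean_space \<Rightarrow> real"
  assumes "f differentiable (at x)"
  shows "GDERIV f x :> gradient f x"
proof -
  obtain f' where f': "(f has_derivative f') (at x)"
    using assms by (auto simp: differentiable_def)
  then have "linear f'"
    by (rule has_derivative_linear)
  then have "f' = (\<lambda>v. v \<bullet> adjoint f' 1)"
    by (simp add: adjoint_works)
  then have "GDERIV f x :> adjoint f' 1"
    using f' by (simp add: gderiv_def)
  then show ?thesis
    unfolding gradient_def by (rule theI) (use GDERIV_unique \<open>GDERIV f x :> adjoint f' 1\<close> in blast)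
qed

text \<open>Divide the strong convexity inequality on the segment from \<open>x\<close> to
  \<open>y\<close> by \<open>\<theta>\<close> and let \<open>\<theta>\<close> tend to
  \<open>0\<close> from the right.\<close>

lemma strongly_convex_lower_bound:
  fixes f :: "'a::euclidean_space \<Rightarrow> real"
  assumes sc: "strongly_convex \<alpha> f" and g: "GDERIV f x :> g"
  shows "f y \<ge> f x + (y - x) \<bullet> g + \<alpha> / 2 * (norm (y - x))\<^sup>2"
proof -
  let ?h = "\<lambda>\<theta>. f (x + \<theta> *\<^sub>R (y - x))"
  have "((\<lambda>\<theta>::real. x + \<theta> *\<^sub>R (y - x)) has_derivative (\<lambda>\<theta>. \<theta> *\<^sub>R (y - x))) (at 0)"
    by (auto intro!: derivative_eq_intros)
  moreover have "(f has_derivative (\<lambda>v. v \<bullet> g)) (at (x + 0 *\<^sub>R (y - x)))"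
    using g by (simp add: gderiv_def)
  ultimately have "(?h has_derivative (\<lambda>\<theta>. (\<theta> *\<^sub>R (y - x)) \<bullet> g)) (at 0)"
    by (rule has_derivative_compose)
  then have "DERIV ?h 0 :> (y - x) \<bullet> g"
    by (simp add: has_field_derivative_def mult_commute_abs)
  then have lim: "((\<lambda>\<theta>. (?h \<theta> - f x) / \<theta>) \<longlongrightarrow> (y - x) \<bullet> g) (at_right 0)"
    using filterlim_at_split by (auto simp: has_field_derivative_iff)
  \<comment> \<open>The factor \<open>1 - \<theta>\<close> tends to \<open>1\<close>, which gives
    the full constant \<open>\<alpha> / 2\<close>.\<close>
  have lim': "((\<lambda>\<theta>. f y - f x - \<alpha> / 2 * (1 - \<theta>) * (norm (y - x))\<^sup>2)
      \<longlongrightarrow> f y - f x - \<alpha> / 2 * (1 - 0) * (norm (y - x))\<^sup>2) (at_right 0)"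
    by (intro tendsto_intros)
  have "eventually (\<lambda>\<theta>. (?h \<theta> - f x) / \<theta> \<le> f y - f x - \<alpha> / 2 * (1 - \<theta>) * (norm (y - x))\<^sup>2)
      (at_right 0)"
    using eventually_at_right_real[OF zero_less_one]
  proof eventually_elim
    case (elim \<theta>)
    have "f (\<theta> *\<^sub>R y + (1 - \<theta>) *\<^sub>R x)
       \<le> \<theta> * f y + (1 - \<theta>) * f x - \<alpha> / 2 * \<theta> * (1 - \<theta>) * (norm (y - x))\<^sup>2"
      using sc elim unfolding strongly_convex_def by auto
    moreover have "\<theta> *\<^sub>R y + (1 - \<theta>) *\<^sub>R x = x + \<theta> *\<^sub>R (y - x)"
      by (simp add: algebra_simps)
    ultimately have "?h \<theta> - f x \<le> \<theta> * (f y - f x - \<alpha> / 2 * (1 - \<theta>) * (norm (y - x))\<^sup>2)"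
      by (simp add: algebra_simps)
    then show ?case
      using elim by (simp add: pos_divide_le_eq mult.commute)
  qed
  then have "(y - x) \<bullet> g \<le> f y - f x - \<alpha> / 2 * (1 - 0) * (norm (y - x))\<^sup>2"
    using tendsto_le[OF _ lim' lim] by simp
  then show ?thesis by simp
qed

text \<open>Adding the lower bounds at \<open>x\<close> and at \<open>y\<close> cancels the function
  values, and the two halves of \<open>\<alpha>\<close> add up.\<close>

lemma strongly_convex_gradient_monotone:
  fixes f :: "'a::euclidean_space \<Rightarrow> real"
  assumes "strongly_convex \<alpha> f" and "\<And>y. f differentiable (at y)"
  shows "\<alpha> * (norm (x - y))\<^sup>2 \<le> (x - y) \<bullet> (gradient f x - gradient f y)"
  using strongly_convex_lower_bound[OF assms(1) GDERIV_gradient[OF assms(2)], of x y]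
    strongly_convex_lower_bound[OF assms(1) GDERIV_gradient[OF assms(2)], of y x]
  by (simp add: norm_minus_commute inner_diff_left inner_diff_right algebra_simps)

text \<open>Fermat's rule for the sum, with the derivative tested in the direction of the summed
  gradient itself.\<close>

lemma sum_gradient_at_minimizer:
  fixes f :: "'n::finite \<Rightarrow> 'a::euclidean_space \<Rightarrow> real"
  assumes "\<And>i y. f i differentiable (at y)"
    and "is_arg_min (\<lambda>y. \<Sum>i\<in>UNIV. f i y) (\<lambda>_. True) x"
  shows "(\<Sum>i\<in>UNIV. gradient (f i) x) = 0"
proof -
  let ?g = "\<Sum>i\<in>UNIV. gradient (f i) x"
  have "((\<lambda>y. \<Sum>i\<in>UNIV. f i y) has_derivative (\<lambda>h. \<Sum>i\<in>UNIV. h \<bullet> gradient (f i) x)) (at x)"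
    using GDERIV_gradient[OF assms(1)] unfolding gderiv_def by (intro has_derivative_sum)
  moreover have "\<forall>y\<in>UNIV. (\<Sum>i\<in>UNIV. f i x) \<le> (\<Sum>i\<in>UNIV. f i y)"
    using assms(2) by (auto simp: is_arg_min_linorder)
  ultimately have "(\<lambda>h. \<Sum>i\<in>UNIV. h \<bullet> gradient (f i) x) = (\<lambda>h. 0)"
    by (intro differential_zero_maxmin[of x UNIV "\<lambda>y. \<Sum>i\<in>UNIV. f i y"]) auto
  then have "?g \<bullet> ?g = 0"
    by (metis inner_sum_right)
  then show ?thesis by simp
qed

section \<open>Stacked vectors and the weighted Laplacian\<close>

lemma block_col [simp]: "block (col v) i = v i"
  by (simp add: block_def col_def vec_eq_iff)

lemma block_diff [simp]: "block (x - y) i = block x i - block y i"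
  by (simp add: block_def vec_eq_iff)

lemma block_eqI: "(\<And>i. block x i = block y i) \<Longrightarrow> x = y"
  by (simp add: block_def vec_eq_iff)

lemma sum_UNIV_prod:
  "(\<Sum>p\<in>UNIV. h p) = (\<Sum>i\<in>UNIV. \<Sum>k\<in>UNIV. h (i :: 'a::finite, k :: 'b::finite))"
  by (simp add: sum.cartesian_product)

lemma inner_block: "x \<bullet> y = (\<Sum>i\<in>UNIV. block x i \<bullet> block y i)"
  by (simp add: inner_vec_def block_def sum_UNIV_prod)

lemma norm_block_squares: "(norm x)\<^sup>2 = (\<Sum>i\<in>UNIV. (norm (block x i))\<^sup>2)"
  using inner_block[of x x] by (simp add: dot_square_norm)

lemma norm_block_le: "norm (block x i) \<le> norm x"
proof (rule power2_le_imp_le)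
  show "(norm (block x i))\<^sup>2 \<le> (norm x)\<^sup>2"
    unfolding norm_block_squares by (rule member_le_sum) auto
qed simp

text \<open>The identity factor decouples the coordinates, and the diagonal degree spreads over the
  row to form differences, in which self-loops cancel.\<close>

lemma block_laplacian:
  fixes W :: "real ^ 'n ^ 'n::finite" and x :: "real ^ ('n \<times> 'd::finite)"
  shows "block (kronecker (laplacian W) (mat 1) *v x) i
     = (\<Sum>j\<in>UNIV. W $ i $ j *\<^sub>R (block x i - block x j))"
proof -
  have "(kronecker (laplacian W) (mat 1 :: real ^ 'd ^ 'd) *v x) $ (i, k)
      = (\<Sum>j\<in>UNIV. laplacian W $ i $ j * x $ (j, k))" for k :: 'd
    by (simp add: kronecker_def matrix_vector_mult_def mat_def sum_UNIV_prod if_distrib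
        if_distribR cong: if_cong)
  moreover have "(\<Sum>j\<in>UNIV. laplacian W $ i $ j * x $ (j, k))
      = (\<Sum>j\<in>UNIV. W $ i $ j * (x $ (i, k) - x $ (j, k)))" for k :: 'd
  proof -
    have "laplacian W $ i $ j * a = (if i = j then (\<Sum>n\<in>UNIV. W $ i $ n) * a else 0) - W $ i $ j * a"
      for j a
      by (simp add: laplacian_def degree_matrix_def left_diff_distrib)
    then show ?thesis
      by (simp add: sum_subtractf right_diff_distrib sum_distrib_right)
  qed
  ultimately show ?thesis
    by (simp add: block_def vec_eq_iff)
qed

text \<open>Exchanging \<open>i\<close> and \<open>j\<close> and averaging gives the Dirichlet form
  of the graph, from which self-adjointness and positivity can be read off.\<close>

lemma inner_laplacian:
  assumes "transpose W = W"
  shows "(kronecker (laplacian W) (mat 1) *v x) \<bullet> y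
     = (\<Sum>i\<in>UNIV. \<Sum>j\<in>UNIV. W $ i $ j * ((block x i - block x j) \<bullet> (block y i - block y j))) / 2"
proof -
  let ?S = "\<lambda>i j. W $ i $ j * ((block x i - block x j) \<bullet> block y i)"
  have sym: "W $ j $ i = W $ i $ j" for i j
    by (metis assms transpose_def vec_lambda_beta)
  have "(kronecker (laplacian W) (mat 1) *v x) \<bullet> y = (\<Sum>i\<in>UNIV. \<Sum>j\<in>UNIV. ?S i j)"
    by (simp add: inner_block block_laplacian inner_sum_left)
  moreover have "(\<Sum>i\<in>UNIV. \<Sum>j\<in>UNIV. ?S i j)
      = (\<Sum>i\<in>UNIV. \<Sum>j\<in>UNIV. W $ i $ j * ((block x j - block x i) \<bullet> block y j))"
    by (subst sum.swap) (simp add: sym)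
  moreover have "W $ i $ j * ((block x i - block x j) \<bullet> (block y i - block y j))
      = ?S i j + W $ i $ j * ((block x j - block x i) \<bullet> block y j)" for i j
    by (simp add: inner_diff_left inner_diff_right algebra_simps)
  ultimately show ?thesis
    by (simp add: sum.distrib)
qed

text \<open>The Dirichlet form of \<open>x\<close> is a vanishing sum of nonnegative terms, so
  blocks agree across each edge and, by connectivity, along paths.\<close>

lemma laplacian_kernel_consensus:
  fixes W :: "real ^ 'n ^ 'n::finite" and x :: "real ^ ('n \<times> 'd::finite)"
  assumes E: "undirected_connected E" and W: "weighted_adjacency E W"
    and "kronecker (laplacian W) (mat 1) *v x = 0"
  shows "block x i = block x j"
proof -
  have W0: "0 \<le> W $ i $ j" for i j
    using W unfolding weighted_adjacency_def by (metis less_eq_real_def)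
  let ?q = "\<lambda>i j. W $ i $ j * ((block x i - block x j) \<bullet> (block x i - block x j))"
  have "transpose W = W"
    using W by (simp add: weighted_adjacency_def)
  from inner_laplacian[OF this, of x x] assms(3)
  have "(\<Sum>i\<in>UNIV. \<Sum>j\<in>UNIV. ?q i j) = 0"
    by simp
  then have q: "?q i j = 0" for i j
    using W0 by (simp add: sum_nonneg_eq_0_iff sum_nonneg)
  have step: "block x i = block x j" if "(i, j) \<in> E" for i j
    using q[of i j] W that unfolding weighted_adjacency_def by (metis eq_iff_diff_eq_0
        inner_eq_zero_iff mult_eq_0_iff order_less_irrefl)
  have "(i, j) \<in> E\<^sup>*"
    using E by (simp add: undirected_connected_def)
  then show ?thesis
    by (induction rule: rtrancl_induct) (auto dest: step)
qed

section \<open>Reduction of gradient tracking to the saddle-point flow\<close>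

theorem mainTheorem1:
  fixes E :: "('n::finite \<times> 'n) set"
    and W :: "real ^ 'n ^ 'n"
    and f :: "'n \<Rightarrow> real ^ 'd::finite \<Rightarrow> real"
    and \<alpha> \<beta> :: real
    and xstar :: "real ^ 'd"
    and x0 z0 :: "real ^ ('n \<times> 'd)"
  assumes "\<alpha> > 0"
    and "\<And>i y. f i differentiable (at y)"
    and "\<And>i. strongly_convex \<alpha> (f i)"
    and "\<beta> > 0"
    and "\<And>i. \<beta>-lipschitz_on UNIV (gradient (f i))"
    and "undirected_connected E"
    and "refl E"
    and "weighted_adjacency E W"
    and "is_arg_min (\<lambda>y. \<Sum>i\<in>UNIV. f i y) (\<lambda>_. True) xstar"
    and "(\<Sum>i\<in>UNIV. block z0 i) = 0"
  shows "\<exists>a1>0. \<exists>a2>0. \<forall>x z.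
           gradient_tracking_solution W f x z \<and> x 0 = x0 \<and> z 0 = z0 \<longrightarrow>
           (\<forall>t\<ge>0. \<forall>i. norm (block (x t) i - xstar) \<le> a1 * exp (- a2 * t))"
proof -
  define L where "L = (\<lambda>x. kronecker (laplacian W) (mat 1 :: real ^ 'd ^ 'd) *v x)"
  define G where "G = stacked_gradient f"
  define xs :: "real ^ ('n \<times> 'd)" where "xs = col (\<lambda>_. xstar)"
  have linL: "linear L"
    unfolding L_def by (rule matrix_vector_mul_linear)
  interpret L: linear L by fact
  have tW: "transpose W = W" and W0: "\<And>i j. 0 \<le> W $ i $ j"
    using assms(8) unfolding weighted_adjacency_def by (auto, metis less_eq_real_def)
  have adj: "L x \<bullet> y = x \<bullet> L y" for x y
    by (simp add: L_def inner_laplacian[OF tW] inner_commute[of x] inner_commute[of "block y _ - _"])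
  have psd: "0 \<le> x \<bullet> L x" for x
    by (simp add: L_def inner_commute[of x] inner_laplacian[OF tW] W0 sum_nonneg)
  have Lxs: "L xs = 0"
    by (rule block_eqI) (simp add: L_def xs_def block_laplacian, simp add: block_def vec_eq_iff)
  have G_block: "block (G x) i = gradient (f i) (block x i)" for x i
    by (simp add: G_def stacked_gradient_def)
  have xs_block: "block xs i = xstar" for i
    by (simp add: xs_def)
  have mono: "\<alpha> * (norm (x - xs))\<^sup>2 \<le> (x - xs) \<bullet> (G x - G xs)" for x
    unfolding norm_block_squares inner_block sum_distrib_left
    by (intro sum_mono) (simp add: G_block strongly_convex_gradient_monotone assms(2,3))
  have lip: "norm (G x - G xs) \<le> \<beta> * norm (x - xs)" for x
  proof (rule power2_le_imp_le)
    have "(norm (gradient (f i) (block x i) - gradient (f i) xstar))\<^sup>2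
        \<le> \<beta>\<^sup>2 * (norm (block x i - xstar))\<^sup>2" for i
      using lipschitz_onD[OF assms(5)[of i], of "block x i" xstar]
      by (simp add: dist_norm power_mono flip: power_mult_distrib)
    then show "(norm (G x - G xs))\<^sup>2 \<le> (\<beta> * norm (x - xs))\<^sup>2"
      unfolding power_mult_distrib norm_block_squares sum_distrib_left
      by (intro sum_mono) (simp add: G_block xs_block)
  qed (use assms(4) in simp)
  define p0 where "p0 = z0 - L x0 + G xs"
  have perp: "p0 \<bullet> b = 0" if "L b = 0" for b
  proof -
    \<comment> \<open>\<open>undefined\<close> is an arbitrary reference agent; all blocks of
      \<open>b\<close> equal its block.\<close>
    have b: "block b i = block b undefined" for i
      using laplacian_kernel_consensus[OF assms(6,8)] that unfolding L_def by blast
    have "z0 \<bullet> b = (\<Sum>i\<in>UNIV. block z0 i) \<bullet> block b undefined"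
      unfolding inner_block[of z0] inner_sum_left by (subst b) simp
    moreover have "G xs \<bullet> b = (\<Sum>i\<in>UNIV. gradient (f i) xstar) \<bullet> block b undefined"
      unfolding inner_block[of "G xs"] inner_sum_left by (subst b) (simp add: G_block xs_block)
    moreover have "L x0 \<bullet> b = 0"
      by (simp add: adj that)
    ultimately show ?thesis
      using sum_gradient_at_minimizer[OF assms(2,9)] assms(10)
      by (simp add: p0_def inner_diff_left inner_add_left)
  qed
  obtain A c where A: "A > 0" and c: "c > 0" and decay: "\<And>e p g t. \<lbrakk>\<And>t. t \<ge> 0 \<Longrightarrow>
        (e has_vector_derivative - (2 *\<^sub>R L (e t)) - p t - g t) (at t within {0..}) \<and>
        (p has_vector_derivative L (L (e t))) (at t within {0..}) \<and>
        \<alpha> * (norm (e t))\<^sup>2 \<le> e t \<bullet> g t \<and> norm (g t) \<le> \<beta> * norm (e t);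
        \<And>b. L b = 0 \<Longrightarrow> p 0 \<bullet> b = 0; t \<ge> 0\<rbrakk>
      \<Longrightarrow> norm (e t) \<le> A * (norm (e 0) + norm (p 0)) * exp (- c * t)"
    using saddle_flow_decay[OF linL adj psd assms(1) less_imp_le[OF assms(4)]] by metis
  \<comment> \<open>The summand \<open>1\<close> keeps \<open>a1\<close> positive when the initial
    errors vanish.\<close>
  define a1 where "a1 = A * (norm (x0 - xs) + norm p0) + 1"
  have "a1 > 0"
    using A by (simp add: a1_def add_nonneg_pos)
  moreover have "norm (block (x t) i - xstar) \<le> a1 * exp (- c * t)"
    if sol: "gradient_tracking_solution W f x z" and x0: "x 0 = x0" and z0: "z 0 = z0" and "t \<ge> 0"
    for x z t i
  proof -
    define e where "e = (\<lambda>t. x t - xs)"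
    define p where "p = (\<lambda>t. z t - L (x t) + G xs)"
    define g where "g = (\<lambda>t. G (x t) - G xs)"
    have Le: "L (e t) = L (x t)" for t
      by (simp add: e_def L.diff Lxs)
    have dyn: "(e has_vector_derivative - (2 *\<^sub>R L (e t)) - p t - g t) (at t within {0..}) \<and>
        (p has_vector_derivative L (L (e t))) (at t within {0..})" if "t \<ge> 0" for t
    proof
      have dx: "(x has_vector_derivative - L (x t) - z t - G (x t)) (at t within {0..})"
        and dz: "(z has_vector_derivative - L (z t) - L (G (x t))) (at t within {0..})"
        using sol that by (auto simp: gradient_tracking_solution_def Let_def L_def G_def)
      \<comment> \<open>The \<open>- L (x t)\<close> inside \<open>p\<close> accounts for the factor
        \<open>2\<close>, and the constant \<open>G xs\<close> cancels between \<open>p\<close> and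
        \<open>g\<close>.\<close>
      have "- (2 *\<^sub>R L (e t)) - p t - g t = - L (x t) - z t - G (x t)"
        by (simp add: Le p_def g_def scaleR_2)
      then show "(e has_vector_derivative - (2 *\<^sub>R L (e t)) - p t - g t) (at t within {0..})"
        unfolding e_def using has_vector_derivative_diff[OF dx has_vector_derivative_const] by simp
      \<comment> \<open>Subtracting this from the equation for \<open>z\<close> cancels
        \<open>L (z t)\<close> and \<open>L (G (x t))\<close>, so the nonlinearity disappears from
        the equation for \<open>p\<close>.\<close>
      have "((\<lambda>t. L (x t)) has_vector_derivative L (- L (x t) - z t - G (x t))) (at t within {0..})"
        using bounded_linear.has_vector_derivative[OF _ dx] linL by (simp add: linear_linear)
      from has_vector_derivative_add[OF has_vector_derivative_diff[OF dz this]
          has_vector_derivative_const[of "G xs"]]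
      show "(p has_vector_derivative L (L (e t))) (at t within {0..})"
        by (simp add: p_def Le L.diff L.neg)
    qed
    have "norm (e t) \<le> A * (norm (e 0) + norm (p 0)) * exp (- c * t)"
    proof (rule decay)
      show "(e has_vector_derivative - (2 *\<^sub>R L (e t)) - p t - g t) (at t within {0..}) \<and>
        (p has_vector_derivative L (L (e t))) (at t within {0..}) \<and>
        \<alpha> * (norm (e t))\<^sup>2 \<le> e t \<bullet> g t \<and> norm (g t) \<le> \<beta> * norm (e t)" if "t \<ge> 0" for t
        using dyn[OF that] mono lip by (simp add: e_def g_def)
      show "p 0 \<bullet> b = 0" if "L b = 0" for b
        using perp[OF that] by (simp add: p_def p0_def x0 z0)
    qed fact
    also have "\<dots> \<le> a1 * exp (- c * t)"
      by (simp add: a1_def e_def p_def p0_def x0 z0)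
    finally show ?thesis
      using norm_block_le[of "e t" i] by (simp add: e_def xs_block)
  qed
  ultimately show ?thesis
    using c by blast
qed

end
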